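(* Let $a\geq 2$ be an integer. Then the graph $K_4(a-2,a-1,a+1,a+2)$ is transmission irregular if and only if $a\not\equiv 2 \pmod 3$.
   Context: For a vertex $x$ of a finite simple connected graph $G$, $\mathrm{Tr}_G(x)=\sum_{u\in V(G)\setminus\{x\}}d_G(x,u)$ is its transmission, where $d_G$ is the shortest-path distance. $G$ is transmission irregular if any two distinct vertices have different transmissions. For integers $k_1,k_2,k_3,k_4\ge 0$, $K_4(k_1,k_2,k_3,k_4)$ is the graph obtained from the complete graph $K_4$ by attaching pendant paths of lengths $k_1,k_2,k_3,k_4$, respectively, to its four vertices (one path at each vertex). Here attaching a pendant path of length $\ell$ at a vertex $v$ means adding $\ell$ new vertices $p_1,\ldots,p_\ell$ and the edges $vp_1,p_1p_2,\ldots,p_{\ell-1}p_\ell$ (nothing is added if $\ell=0$). *)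

theory Defs
  imports "Graph_Theory.Graph_Theory" "HOL-Number_Theory.Cong"
begin

text \<open>
  A simple graph is a symmetric digraph without loops (locale \<^locale>\<open>pair_graph\<close>): every
  edge is represented by its two arcs. The shortest-path distance is the library's weighted
  distance with all arc weights equal to 1, so that the cost of a walk is its length; it is
  \<^typ>\<open>ereal\<close>-valued, with \<open>\<infinity>\<close> for unreachable pairs.
\<close>

definition gdist :: "('a, 'b) pre_digraph \<Rightarrow> 'a \<Rightarrow> 'a \<Rightarrow> ereal" where
  "gdist G u v = wf_digraph.\<mu> G (\<lambda>_. 1) u v"

definition transmission :: "('a, 'b) pre_digraph \<Rightarrow> 'a \<Rightarrow> ereal" where
  "transmission G x = (\<Sum>u\<in>verts G - {x}. gdist G x u)"

text \<open>Intended for finite simple connected graphs only.\<close>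

definition transmission_irregular :: "('a, 'b) pre_digraph \<Rightarrow> bool" where
  "transmission_irregular G \<longleftrightarrow>
     (\<forall>x\<in>verts G. \<forall>y\<in>verts G. x \<noteq> y \<longrightarrow> transmission G x \<noteq> transmission G y)"

text \<open>
  Attaching a pendant path of length \<open>k v\<close> at every vertex \<open>v\<close> of \<open>H\<close>: the pair \<open>(v, 0)\<close>
  is the old vertex \<open>v\<close>, and \<open>(v, j)\<close> with \<open>1 \<le> j \<le> k v\<close> is the \<open>j\<close>-th new vertex \<open>p\<^sub>j\<close> of
  the path attached at \<open>v\<close>.
\<close>

definition attach_paths :: "'a pair_pre_digraph \<Rightarrow> ('a \<Rightarrow> nat) \<Rightarrow> ('a \<times> nat) pair_pre_digraph" where
  "attach_paths H k = \<lparr>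
     pverts = {(v, j). v \<in> pverts H \<and> j \<le> k v},
     parcs = {((u, 0), (v, 0)) | u v. (u, v) \<in> parcs H}
           \<union> {((v, j), (v, Suc j)) | v j. v \<in> pverts H \<and> j < k v}
           \<union> {((v, Suc j), (v, j)) | v j. v \<in> pverts H \<and> j < k v} \<rparr>"

definition complete_graph :: "nat \<Rightarrow> nat pair_pre_digraph" where
  "complete_graph n = \<lparr> pverts = {..<n}, parcs = {(u, v). u < n \<and> v < n \<and> u \<noteq> v} \<rparr>"

definition K4_paths :: "nat \<Rightarrow> nat \<Rightarrow> nat \<Rightarrow> nat \<Rightarrow> (nat \<times> nat) pair_pre_digraph" where
  "K4_paths k1 k2 k3 k4 = attach_paths (complete_graph 4) (\<lambda>i. [k1, k2, k3, k4] ! i)"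

lemma complete_digraph_complete_graph: "complete_digraph n (with_proj (complete_graph n))"
proof -
  have "finite {(u, v). u < n \<and> v < n \<and> u \<noteq> v}"
    by (rule finite_subset[of _ "{..<n} \<times> {..<n}"]) auto
  then have "pair_graph (complete_graph n)"
    by unfold_locales (auto simp: complete_graph_def symmetric_def sym_def)
  then show ?thesis
    by (auto simp: complete_digraph_def complete_graph_def dest: pair_graph.pair_graphD_graph)
qed

lemma pair_graph_attach_paths:
  assumes "pair_graph H"
  shows "pair_graph (attach_paths H k)"
proof -
  interpret H: pair_graph H by fact
  let ?V = "{(v, j). v \<in> pverts H \<and> j \<le> k v}"
  have "?V = Sigma (pverts H) (\<lambda>v. {..k v})" by auto
  then have fin: "finite ?V" using H.pair_finite_verts by auto
  have sub: "parcs (attach_paths H k) \<subseteq> ?V \<times> ?V"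
    by (auto simp: attach_paths_def dest: H.wellformed')
  then have "finite (parcs (attach_paths H k))"
    using fin by (meson finite_SigmaI finite_subset)
  moreover have "pverts (attach_paths H k) = ?V" by (simp add: attach_paths_def)
  moreover have "sym (parcs (attach_paths H k))"
    by (auto simp: attach_paths_def sym_def dest: H.arcs_symmetric)
  moreover have "fst e \<noteq> snd e" if "e \<in> parcs (attach_paths H k)" for e
    using that by (auto simp: attach_paths_def dest: H.pair_no_loops)
  ultimately show ?thesis
    using fin sub by unfold_locales (auto simp: symmetric_def)
qed

lemma pair_graph_K4_paths: "pair_graph (K4_paths k1 k2 k3 k4)"
proof -
  have "pair_graph (complete_graph 4)"
    using complete_digraph_complete_graph by (auto simp: complete_digraph_def intro: pair_graphI_graph)
  then show ?thesis unfolding K4_paths_def by (rule pair_graph_attach_paths)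
qed

lemma connected_K4_paths: "Digraph_Component.connected (with_proj (K4_paths k1 k2 k3 k4))"
proof -
  let ?G = "K4_paths k1 k2 k3 k4" and ?k = "\<lambda>i. [k1, k2, k3, k4] ! i"
  interpret pair_graph ?G by (rule pair_graph_K4_paths)
  have V: "pverts ?G = {(i, j). i < 4 \<and> j \<le> ?k i}"
    by (auto simp: K4_paths_def attach_paths_def complete_graph_def)
  have down: "(i, j) \<rightarrow>\<^sup>*\<^bsub>with_proj ?G\<^esub> (i, 0)" if "i < 4" "j \<le> ?k i" for i j
    using that(2)
  proof (induction j)
    case 0
    then show ?case using that(1) V by (intro reachable_refl) auto
  next
    case (Suc j)
    then have "((i, Suc j), (i, j)) \<in> parcs ?G"
      using that(1) by (auto simp: K4_paths_def attach_paths_def complete_graph_def)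
    with Suc show ?case using adj_reachable_trans by auto
  qed
  have mid: "(i, 0) \<rightarrow>\<^sup>*\<^bsub>with_proj ?G\<^esub> (i', 0)" if "i < 4" "i' < 4" for i i'
  proof (cases "i = i'")
    case True
    then show ?thesis using down[of i 0] that by simp
  next
    case False
    then have "((i, 0), (i', 0)) \<in> parcs ?G"
      using that by (auto simp: K4_paths_def attach_paths_def complete_graph_def)
    then show ?thesis by (rule reachable_adjI)
  qed
  have "x \<rightarrow>\<^sup>*\<^bsub>with_proj ?G\<^esub> y" if "x \<in> pverts ?G" "y \<in> pverts ?G" for x y
  proof -
    obtain i j i' j' where [simp]: "x = (i, j)" "y = (i', j')" by (cases x, cases y)
    have *: "i < 4" "j \<le> ?k i" "i' < 4" "j' \<le> ?k i'" using that V by auto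
    have "(i', 0) \<rightarrow>\<^sup>*\<^bsub>with_proj ?G\<^esub> (i', j')"
      using symmetric_reachable[OF sym_arcs down[OF *(3,4)]] by simp
    then show ?thesis
      using down[OF *(1,2)] mid[OF *(1,3)] by (auto intro: reachable_trans)
  qed
  moreover have "(0, 0) \<in> pverts ?G" using V by auto
  ultimately show ?thesis
    unfolding Digraph_Component.connected_def strongly_connected_def
    using reachable_mk_symmetricI by auto
qed

end

theory Submission
  imports Defs
begin

text \<open>
  In \<open>K\<^sub>n\<close> with a path of length \<open>k i\<close> attached at each vertex \<open>i\<close>, moving one step outwards on
  branch \<open>i\<close>, from position \<open>j\<close> to \<open>j + 1\<close>, brings the \<open>k i - j\<close> outer vertices of the branch
  closer by 1 and moves all other vertices away by 1. With \<open>N\<close> vertices in all and \<open>N\<^sub>i = k i + 1\<close>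
  of them on branch \<open>i\<close>, the transmission therefore is a quadratic polynomial along each branch,
  \<open>S + (N - N\<^sub>i) + j * (N - 2 * N\<^sub>i + 1 + j)\<close>, where the sum \<open>S\<close> of all
  distances to the clique does not depend on the branch
  (\<open>transmission_complete_paths\<close>).

  For path lengths \<open>a - 2, a - 1, a + 1, a + 2\<close> we have \<open>N = 4 * a + 4\<close>, and each of the four
  polynomials is strictly increasing, so coincidences occur between different branches only. The
  coefficient \<open>N - 2 * N\<^sub>i + 1\<close> is odd, so the parity of the value is constant on each branch: it
  leaves only the outer pair of branches, 0 and 3, and the inner pair, 1 and 2
  (\<open>even_rel_transmission\<close>). For each pair, let \<open>d\<close> be the difference of the two positions. Equality
  is linear in the position for fixed \<open>d\<close>, and size and parity exclude all \<open>d\<close> but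
  \<open>d = 1\<close>. For the inner pair \<open>d = 1\<close> asks for position \<open>a\<close> on branch 1, one beyond its end
  (\<open>rel_transmission_1_neq_2\<close>). For the outer pair it reads \<open>3 * j = a - 2\<close>
  (\<open>rel_transmission_0_eq_3\<close>), and that is solvable exactly when \<open>a\<close> is 2 modulo 3.
\<close>

section \<open>Distances certified by a potential\<close>

text \<open>
  A potential that grows by at most 1 along every arc bounds the length of every walk from below. If
  moreover every vertex other than the source has a predecessor of potential one less, then
  descending along these predecessors gives a walk that attains the bound. This replaces the
  analysis of all walks in a concrete graph by a check of its arcs.
\<close>

lemma gdist_eqI:
  fixes h :: "'a \<Rightarrow> nat"
  assumes wf: "wf_digraph G" and x: "x \<in> verts G" and v: "v \<in> verts G"
    and h0: "h x = 0"
    and lip: "\<And>e. e \<in> arcs G \<Longrightarrow> h (head G e) \<le> Suc (h (tail G e))"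
    and pred: "\<And>w. \<lbrakk>w \<in> verts G; w \<noteq> x\<rbrakk> \<Longrightarrow> \<exists>e\<in>arcs G. head G e = w \<and> h w = Suc (h (tail G e))"
  shows "gdist G x v = ereal (h v)"
proof -
  interpret wf_digraph G by fact
  have lower: "real (h w) \<le> real (h u) + awalk_cost (\<lambda>_. 1) p" if "awalk u p w" for u p w
    using that
  proof (induction p arbitrary: u)
    case Nil
    then show ?case by (simp add: awalk_Nil_iff)
  next
    case (Cons e p)
    then have "e \<in> arcs G" "tail G e = u" "awalk (head G e) p w"
      by (simp_all add: awalk_Cons_iff)
    then show ?case using Cons.IH[of "head G e"] lip[of e] by simp
  qed
  have upper: "\<exists>p. awalk x p w \<and> awalk_cost (\<lambda>_. 1) p = h w" if "w \<in> verts G" for w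
    using that
  proof (induction "h w" arbitrary: w rule: less_induct)
    case less
    show ?case
    proof (cases "w = x")
      case True
      then show ?thesis using x h0 by (intro exI[of _ "[]"]) (simp add: awalk_Nil_iff)
    next
      case False
      then obtain e where e: "e \<in> arcs G" "head G e = w" "h w = Suc (h (tail G e))"
        using pred less.prems by blast
      then obtain p where "awalk x p (tail G e)" "awalk_cost (\<lambda>_. 1) p = h (tail G e)"
        using less.hyps[of "tail G e"] by auto
      then show ?thesis
        using e arc_implies_awalk[OF e(1)] by (intro exI[of _ "p @ [e]"]) auto
    qed
  qed
  obtain p where "awalk x p v" "awalk_cost (\<lambda>_. 1) p = h v" using upper[OF v] by blast
  then have "\<mu> (\<lambda>_. 1) x v \<le> ereal (h v)"
    using min_cost_le_walk_cost[of x p v "\<lambda>_. 1"] by simp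
  moreover have "ereal (h v) \<le> \<mu> (\<lambda>_. 1) x v"
    unfolding \<mu>_def using lower[of x _ v] h0 by (intro INF_greatest) simp
  ultimately show ?thesis unfolding gdist_def by (rule antisym)
qed

section \<open>Transmissions in a complete graph with pendant paths\<close>

fun clique_paths_dist :: "nat \<times> nat \<Rightarrow> nat \<times> nat \<Rightarrow> nat" where
  "clique_paths_dist (i, j) (l, m) = (if l = i then (j - m) + (m - j) else j + 1 + m)"

lemma pair_graph_complete_graph: "pair_graph (complete_graph n)"
  using complete_digraph_complete_graph by (auto simp: complete_digraph_def intro: pair_graphI_graph)

lemma gdist_complete_paths:
  assumes x: "x \<in> pverts (attach_paths (complete_graph n) k)"
    and v: "v \<in> pverts (attach_paths (complete_graph n) k)"
  shows "gdist (with_proj (attach_paths (complete_graph n) k)) x v = ereal (clique_paths_dist x v)"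
proof (rule gdist_eqI)
  let ?G = "attach_paths (complete_graph n) k"
  interpret pair_graph ?G by (intro pair_graph_attach_paths pair_graph_complete_graph)
  obtain i j where xij: "x = (i, j)" by (cases x)
  have ij: "i < n" "j \<le> k i" using x by (auto simp: xij attach_paths_def complete_graph_def)
  show "wf_digraph (with_proj ?G)" by unfold_locales
  show "x \<in> verts (with_proj ?G)" "v \<in> verts (with_proj ?G)" using x v by simp_all
  show "clique_paths_dist x x = 0" by (simp add: xij)
  show "clique_paths_dist x (head ?G e) \<le> Suc (clique_paths_dist x (tail ?G e))"
    if "e \<in> arcs (with_proj ?G)" for e
    using that by (auto simp: xij attach_paths_def complete_graph_def)
  show "\<exists>e\<in>arcs (with_proj ?G). head ?G e = w \<and> clique_paths_dist x w = Suc (clique_paths_dist x (tail ?G e))"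
    if w: "w \<in> verts (with_proj ?G)" "w \<noteq> x" for w
  proof -
    obtain l m where wlm: "w = (l, m)" by (cases w)
    have lm: "l < n" "m \<le> k l" using w by (auto simp: wlm attach_paths_def complete_graph_def)
    \<comment> \<open>The predecessor of \<open>w\<close> is its neighbour in the direction of \<open>x\<close>: the next vertex outwards if
      \<open>w\<close> lies between \<open>x\<close> and the clique, the next vertex inwards if \<open>w\<close> lies beyond \<open>x\<close> or on the
      path of another branch, and the clique vertex of the branch of \<open>x\<close> if \<open>w\<close> is another clique vertex.\<close>
    consider "l = i" "m < j" | m' where "m = Suc m'" "l = i \<longrightarrow> j < m" | "l \<noteq> i" "m = 0"
      using w(2) by (cases m j rule: linorder_cases; cases m) (auto simp: wlm xij)
    then show ?thesis
    proof cases
      case 1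
      then show ?thesis using ij lm
        by (intro bexI[of _ "((i, Suc m), (i, m))"])
           (auto simp: wlm xij attach_paths_def complete_graph_def)
    next
      case 2
      then show ?thesis using ij lm
        by (intro bexI[of _ "((l, m'), (l, m))"])
           (auto simp: wlm xij attach_paths_def complete_graph_def)
    next
      case 3
      then show ?thesis using ij lm
        by (intro bexI[of _ "((i, 0), (l, m))"])
           (auto simp: wlm xij attach_paths_def complete_graph_def)
    qed
  qed
qed

text \<open>
  Moving from \<open>j\<close> to \<open>j + 1\<close> adds 1 to the distance for the \<open>j + 1\<close> points \<open>m \<le> j\<close> and subtracts 1
  for the other \<open>k - j\<close> points; these increments add up to \<open>j * (j - k)\<close>.
\<close>

lemma sum_abs_diff_atMost:
  fixes j k :: nat
  assumes "j \<le> k"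
  shows "(\<Sum>m\<le>k. \<bar>int j - int m\<bar>) = (\<Sum>m\<le>k. int m) + int j * (int j - int k)"
  using assms
proof (induction j)
  case (Suc j)
  have step: "\<bar>int (Suc j) - int m\<bar> = \<bar>int j - int m\<bar> + (if m \<le> j then 1 else - 1)" for m
    by auto
  have "{..k} \<inter> {m. m \<le> j} = {..j}" "{..k} \<inter> - {m. m \<le> j} = {Suc j..k}" using Suc.prems by auto
  then have "(\<Sum>m\<le>k. if m \<le> j then 1 else - 1 :: int) = 2 * int j + 1 - int k"
    using Suc.prems by (simp add: sum.If_cases of_nat_diff)
  then show ?case
    using Suc unfolding step sum.distrib by (simp add: algebra_simps)
qed simp

text \<open>
  If every vertex \<open>(l, m)\<close> were at distance \<open>(j + 1) + m\<close> from \<open>(i, j)\<close>, the total would be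
  \<open>S + (j + 1) * N\<close>. Only the branch of \<open>(i, j)\<close> itself needs a correction.
\<close>

lemma transmission_complete_paths:
  fixes n :: nat and k :: "nat \<Rightarrow> nat"
  defines "S \<equiv> \<Sum>l<n. \<Sum>m\<le>k l. int m" and "N \<equiv> \<Sum>l<n. int (k l) + 1"
  assumes i: "i < n" and j: "j \<le> k i"
  shows "transmission (with_proj (attach_paths (complete_graph n) k)) (i, j)
    = ereal (real_of_int (S + N - (int (k i) + 1) + int j * (N - 2 * (int (k i) + 1) + 1 + int j)))"
proof -
  let ?G = "attach_paths (complete_graph n) k"
  let ?V = "SIGMA l:{..<n}. {..k l}"
  have V: "pverts ?G = ?V" by (auto simp: attach_paths_def complete_graph_def)
  have x: "(i, j) \<in> ?V" using i j by simp
  have branch: "(\<Sum>m\<le>k l. int (clique_paths_dist (i, j) (l, m)))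
      = (\<Sum>m\<le>k l. int m) + (int j + 1) * (int (k l) + 1)
        + (if l = i then int j * (int j - int (k i)) - (int j + 1) * (int (k i) + 1) else 0)" for l
  proof (cases "l = i")
    case True
    have "int (clique_paths_dist (i, j) (l, m)) = \<bar>int j - int m\<bar>" for m using True by auto
    then show ?thesis using True sum_abs_diff_atMost[OF j] by simp
  next
    case False
    then show ?thesis by (simp add: sum.distrib algebra_simps)
  qed
  have "(\<Sum>u\<in>?V. int (clique_paths_dist (i, j) u))
      = (\<Sum>l<n. \<Sum>m\<le>k l. int (clique_paths_dist (i, j) (l, m)))"
    by (subst sum.Sigma) (auto simp: case_prod_beta simp del: clique_paths_dist.simps)
  also have "\<dots> = S + (int j + 1) * N + (int j * (int j - int (k i)) - (int j + 1) * (int (k i) + 1))"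
    using i by (simp add: branch sum.distrib S_def N_def del: clique_paths_dist.simps flip: sum_distrib_left)
  finally have total: "(\<Sum>u\<in>?V. int (clique_paths_dist (i, j) u))
      = S + N - (int (k i) + 1) + int j * (N - 2 * (int (k i) + 1) + 1 + int j)"
    by (simp add: algebra_simps)
  have "transmission (with_proj ?G) (i, j) = (\<Sum>u\<in>?V - {(i, j)}. ereal (clique_paths_dist (i, j) u))"
    unfolding transmission_def using x
    by (intro sum.cong) (auto simp: V gdist_complete_paths simp del: clique_paths_dist.simps)
  also have "\<dots> = ereal (\<Sum>u\<in>?V. real (clique_paths_dist (i, j) u))"
    using x by (simp add: sum.remove[of ?V "(i, j)"])
  also have "(\<Sum>u\<in>?V. real (clique_paths_dist (i, j) u)) = real_of_int (\<Sum>u\<in>?V. int (clique_paths_dist (i, j) u))"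
    by simp
  finally show ?thesis unfolding total .
qed

section \<open>Coincidences between four quadratic sequences\<close>

text \<open>
  The transmission at position \<open>j\<close> of branch \<open>i\<close> in the graph with path lengths
  \<open>a - 2, a - 1, a + 1, a + 2\<close>, less the constant \<open>S\<close>. The listed coefficients are \<open>N - N\<^sub>i\<close> and
  \<open>N - 2 * N\<^sub>i + 1\<close> for \<open>N = 4 * a + 4\<close> and \<open>N\<^sub>i = a - 1, a, a + 2, a + 3\<close>. Integers avoid truncated
  differences.
\<close>

definition rel_transmission :: "int \<Rightarrow> nat \<Rightarrow> int \<Rightarrow> int" where
  "rel_transmission a i j =
     [3 * a + 5, 3 * a + 4, 3 * a + 2, 3 * a + 1] ! i
     + j * ([2 * a + 7, 2 * a + 5, 2 * a + 1, 2 * a - 1] ! i + j)"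

lemma rel_transmission_simps:
  "rel_transmission a 0 j = 3 * a + 5 + j * (2 * a + 7 + j)"
  "rel_transmission a (Suc 0) j = 3 * a + 4 + j * (2 * a + 5 + j)"
  "rel_transmission a 2 j = 3 * a + 2 + j * (2 * a + 1 + j)"
  "rel_transmission a 3 j = 3 * a + 1 + j * (2 * a - 1 + j)"
  by (simp_all add: rel_transmission_def numeral_2_eq_2 numeral_3_eq_3)

text \<open>
  For odd \<open>b\<close> the product \<open>j * (b + j)\<close> is even, so the constant term alone decides the parity.
\<close>

lemma even_rel_transmission:
  assumes "i < 4"
  shows "even (rel_transmission a i j) \<longleftrightarrow> (even a \<longleftrightarrow> i = 1 \<or> i = 2)"
proof -
  have "i = 0 \<or> i = Suc 0 \<or> i = 2 \<or> i = 3" using assms by auto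
  then show ?thesis by (auto simp: rel_transmission_simps)
qed

lemma rel_transmission_less:
  assumes "i < 4" "a \<ge> 2" "0 \<le> j" "j < j'"
  shows "rel_transmission a i j < rel_transmission a i j'"
proof -
  have mono: "j * (b + j) < j' * (b + j')" if "b > 0" for b
    using that assms by (intro mult_strict_mono) auto
  have "i = 0 \<or> i = Suc 0 \<or> i = 2 \<or> i = 3" using assms by auto
  then show ?thesis using \<open>a \<ge> 2\<close> by (auto simp: rel_transmission_simps intro!: mono)
qed

text \<open>
  For \<open>d = j' - j\<close>, equality becomes \<open>4 + j * (8 - 2 * d) = d * (2 * a - 1 + d)\<close>. Branch 0 has the
  larger values at equal positions, so \<open>d > 0\<close>; and for \<open>d \<ge> 4\<close> the left-hand side is at most 4, the
  right-hand side at least 12. Of the remaining values, \<open>d = 2\<close> fails by parity, \<open>d = 3\<close>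
  forces \<open>j = 3 * a + 1\<close>, beyond the end of the branch, and \<open>d = 1\<close> is the conclusion.
\<close>

lemma rel_transmission_0_eq_3:
  assumes a: "a \<ge> 2" and j: "0 \<le> j" "j \<le> a - 2" and j': "0 \<le> j'"
    and eq: "rel_transmission a 0 j = rel_transmission a 3 j'"
  shows "3 * j = a - 2"
proof -
  define d where "d = j' - j"
  have eq': "4 + j * (8 - 2 * d) = d * (2 * a - 1 + d)"
    using eq by (simp add: rel_transmission_simps d_def algebra_simps)
  have "0 < d"
  proof (rule ccontr)
    assume "\<not> 0 < d"
    then have "j' * (2 * a - 1 + j') \<le> j * (2 * a - 1 + j)"
      using a j' by (intro mult_mono) (auto simp: d_def)
    also have "\<dots> \<le> j * (2 * a + 7 + j)"
      using j by (intro mult_left_mono) auto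
    finally show False using eq by (simp add: rel_transmission_simps)
  qed
  moreover have "d < 4"
  proof (rule ccontr)
    assume "\<not> d < 4"
    then have "j * (8 - 2 * d) \<le> 0" using j by (intro mult_nonneg_nonpos) auto
    moreover have "4 * 3 \<le> d * (2 * a - 1 + d)"
      using \<open>\<not> d < 4\<close> a by (intro mult_mono) auto
    ultimately show False using eq' by simp
  qed
  ultimately consider "d = 1" | "d = 2" | "d = 3" by linarith
  then show ?thesis
  proof cases
    case 1
    then show ?thesis using eq' by simp
  next
    case 2
    then have "2 + 2 * j = 2 * a + 1" using eq' by simp
    then show ?thesis by presburger
  next
    case 3
    then show ?thesis using eq' j a by simp
  qed
qed

text \<open>
  The same argument with \<open>2 + j * (4 - 2 * d) = d * (2 * a + 1 + d)\<close>: now \<open>0 < d < 2\<close>, and \<open>d = 1\<close>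
  forces \<open>j = a\<close>, which exceeds the length \<open>a - 1\<close> of the branch.
\<close>

lemma rel_transmission_1_neq_2:
  assumes a: "a \<ge> 2" and j: "0 \<le> j" "j \<le> a - 1" and j': "0 \<le> j'"
  shows "rel_transmission a 1 j \<noteq> rel_transmission a 2 j'"
proof
  assume eq: "rel_transmission a 1 j = rel_transmission a 2 j'"
  define d where "d = j' - j"
  have eq': "2 + j * (4 - 2 * d) = d * (2 * a + 1 + d)"
    using eq by (simp add: rel_transmission_simps d_def algebra_simps)
  have "0 < d"
  proof (rule ccontr)
    assume "\<not> 0 < d"
    then have "j' * (2 * a + 1 + j') \<le> j * (2 * a + 1 + j)"
      using a j' by (intro mult_mono) (auto simp: d_def)
    also have "\<dots> \<le> j * (2 * a + 5 + j)"
      using j by (intro mult_left_mono) auto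
    finally show False using eq by (simp add: rel_transmission_simps)
  qed
  moreover have "d < 2"
  proof (rule ccontr)
    assume "\<not> d < 2"
    then have "j * (4 - 2 * d) \<le> 0" using j by (intro mult_nonneg_nonpos) auto
    moreover have "2 * 3 \<le> d * (2 * a + 1 + d)"
      using \<open>\<not> d < 2\<close> a by (intro mult_mono) auto
    ultimately show False using eq' by simp
  qed
  ultimately have "d = 1" by simp
  then show False using eq' j by simp
qed

lemma rel_transmission_eq_imp:
  assumes a: "a \<ge> 2" and "i < i'" "i' < 4"
    and j: "0 \<le> j" "j \<le> [a - 2, a - 1, a + 1, a + 2] ! i" and j': "0 \<le> j'"
    and eq: "rel_transmission a i j = rel_transmission a i' j'"
  shows "3 * j = a - 2"
proof -
  have "(i = 1 \<or> i = 2) \<longleftrightarrow> (i' = 1 \<or> i' = 2)"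
    using even_rel_transmission[of i a j] even_rel_transmission[of i' a j'] assms by auto
  then have "i = 0 \<and> i' = 3 \<or> i = 1 \<and> i' = 2" using assms(2,3) by auto
  then show ?thesis
    using rel_transmission_0_eq_3[of a j j'] rel_transmission_1_neq_2[of a j j'] a j j' eq by auto
qed

section \<open>Transmission irregularity of \<open>K\<^sub>4(a - 2, a - 1, a + 1, a + 2)\<close>\<close>

theorem theorem4p2:
  fixes a :: nat
  assumes "a \<ge> 2"
  shows "transmission_irregular (with_proj (K4_paths (a - 2) (a - 1) (a + 1) (a + 2)))
    \<longleftrightarrow> \<not> [a = 2] (mod 3)"
proof -
  let ?k = "\<lambda>i. [a - 2, a - 1, a + 1, a + 2] ! i"
  let ?G = "K4_paths (a - 2) (a - 1) (a + 1) (a + 2)"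
  define S where "S = (\<Sum>l<4. \<Sum>m\<le>?k l. int m)"
  have V: "(i, j) \<in> pverts ?G \<longleftrightarrow> i < 4 \<and> j \<le> ?k i" for i j
    by (auto simp: K4_paths_def attach_paths_def complete_graph_def)
  have N: "(\<Sum>l<4. int (?k l) + 1) = 4 * int a + 4"
    using assms by (simp add: eval_nat_numeral of_nat_diff)
  have k_simps: "int (?k 0) = int a - 2" "int (?k (Suc 0)) = int a - 1"
    "int (?k 2) = int a + 1" "int (?k 3) = int a + 2"
    using assms by (simp_all add: of_nat_diff)
  have four: "i = 0 \<or> i = Suc 0 \<or> i = 2 \<or> i = 3" if "i < 4" for i :: nat using that by auto
  have T: "transmission (with_proj ?G) (i, j) = ereal (real_of_int (S + rel_transmission (int a) i (int j)))"
    if "(i, j) \<in> pverts ?G" for i j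
  proof -
    have ij: "i < 4" "j \<le> ?k i" using that V by auto
    have "4 * int a + 4 - (int (?k i) + 1) + int j * (4 * int a + 4 - 2 * (int (?k i) + 1) + 1 + int j)
        = rel_transmission (int a) i (int j)"
      using four[OF ij(1)] assms
      by (elim disjE) (simp_all only: k_simps rel_transmission_simps, simp_all add: algebra_simps)
    then show ?thesis
      unfolding K4_paths_def transmission_complete_paths[where k = ?k, OF ij] N S_def[symmetric]
      by (simp add: algebra_simps)
  qed
  have T_eq: "transmission (with_proj ?G) (i, j) = transmission (with_proj ?G) (i', j')
      \<longleftrightarrow> rel_transmission (int a) i (int j) = rel_transmission (int a) i' (int j')"
    if "(i, j) \<in> pverts ?G" "(i', j') \<in> pverts ?G" for i j i' j'
    unfolding T[OF that(1)] T[OF that(2)] by simp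
  have cong: "[a = 2] (mod 3) \<longleftrightarrow> (\<exists>j. a = 3 * j + 2)"
    using assms unfolding cong_def by presburger
  show ?thesis
  proof
    assume irr: "transmission_irregular (with_proj ?G)"
    show "\<not> [a = 2] (mod 3)"
    proof
      assume "[a = 2] (mod 3)"
      then obtain j where j: "a = 3 * j + 2" using cong by blast
      \<comment> \<open>Position \<open>j\<close> on the shortest branch collides with position \<open>j + 1\<close> on the longest.\<close>
      have "(0, j) \<in> pverts ?G" "(3, j + 1) \<in> pverts ?G"
        unfolding V using j by simp_all
      moreover have "rel_transmission (int a) 0 (int j) = rel_transmission (int a) 3 (int (j + 1))"
        by (simp add: rel_transmission_simps j algebra_simps)
      ultimately show False
        using irr T_eq[of 0 j 3 "j + 1"] unfolding transmission_irregular_def by fastforce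
    qed
  next
    assume "\<not> [a = 2] (mod 3)"
    then have no: "3 * int j \<noteq> int a - 2" for j
      using cong by presburger
    have bound: "int j \<le> [int a - 2, int a - 1, int a + 1, int a + 2] ! i"
      if "(i, j) \<in> pverts ?G" for i j
    proof -
      have "i < 4" "int j \<le> int (?k i)" using that unfolding V by simp_all
      then show ?thesis
        using four[OF \<open>i < 4\<close>] by (elim disjE) (simp_all only: k_simps, simp_all)
    qed
    have neq: "rel_transmission (int a) i (int j) \<noteq> rel_transmission (int a) i' (int j')"
      if "(i, j) \<in> pverts ?G" "(i', j') \<in> pverts ?G" "i < i' \<or> i = i' \<and> j < j'" for i j i' j'
      using that(3)
    proof
      assume "i < i'"
      then show ?thesis
        using rel_transmission_eq_imp[of "int a" i i' "int j" "int j'"] no bound[OF that(1)] that(1,2) assms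
        unfolding V by auto
    next
      assume "i = i' \<and> j < j'"
      then show ?thesis
        using rel_transmission_less[of i "int a" "int j" "int j'"] that(1) assms unfolding V by auto
    qed
    show "transmission_irregular (with_proj ?G)"
      unfolding transmission_irregular_def
    proof (intro ballI impI)
      fix x y assume xy: "x \<in> verts (with_proj ?G)" "y \<in> verts (with_proj ?G)" "x \<noteq> y"
      obtain i j i' j' where [simp]: "x = (i, j)" "y = (i', j')" by (cases x, cases y)
      have "i < i' \<or> i = i' \<and> j < j' \<or> i' < i \<or> i' = i \<and> j' < j" using xy(3) by auto
      then show "transmission (with_proj ?G) x \<noteq> transmission (with_proj ?G) y"
        using neq[of i j i' j'] neq[of i' j' i j] xy(1,2) T_eq[of i j i' j'] by auto
    qed
  qed
qed

end
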